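(* Let $G$ be a triangulation of a simple polygon. Denote by $M(G)$ the cycle matroid of $G$. Then there exists an ordering $\prec$ of the edges of $G$ such that the minimal broken circuits of the ordered matroid $(M(G),\prec)$ are pairwise disjoint.
   Context: A triangulation of a simple polygon is a partition of the polygon into triangles by pairwise non-crossing diagonals; it is viewed as a graph $G$ whose vertices are the vertices of the polygon and whose edges are the sides of the polygon and the diagonals used. The cycle matroid $M(G)$ is the matroid on the edge set of $G$ whose circuits are the edge sets of cycles of $G$. Given a linear ordering $\prec$ of the edges, the broken circuit of a circuit $C$ is $C$ minus its $\prec$-smallest element; minimal broken circuits are the broken circuits that are minimal with respect to inclusion. *)

theory Defs
  imports "HOL-Analysis.Analysis"
begin

section \<open>Graphs, cycle matroids and broken circuits\<close>

text \<open>In a finite simple graph an edge is the two-element set of its endpoints.\<close>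

record 'v graph =
  verts :: "'v set"
  edges :: "'v set set"

definition cycle_edges :: "'v list \<Rightarrow> 'v set set" where
  "cycle_edges vs = {{vs ! i, vs ! (Suc i mod length vs)} | i. i < length vs}"

definition is_cycle :: "'v graph \<Rightarrow> 'v list \<Rightarrow> bool" where
  "is_cycle G vs \<longleftrightarrow>
     3 \<le> length vs \<and> distinct vs \<and> set vs \<subseteq> verts G \<and> cycle_edges vs \<subseteq> edges G"

text \<open>A matroid is presented by its ground set and its family of circuits.\<close>

record 'e matroid =
  ground :: "'e set"
  circuits :: "'e set set"

definition cycle_matroid :: "'v graph \<Rightarrow> 'v set matroid" where
  "cycle_matroid G =
     \<lparr>ground = edges G, circuits = {cycle_edges vs | vs. is_cycle G vs}\<rparr>"

text \<open>The ordering is the reflexive relation \<open>r\<close> of a linear order on the ground set: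
  \<open>(e, f) \<in> r\<close> means that \<open>e\<close> is smaller than or equal to \<open>f\<close>.\<close>

definition broken_circuits :: "'e matroid \<Rightarrow> 'e rel \<Rightarrow> 'e set set" where
  "broken_circuits M r =
     {C - {e} | C e. C \<in> circuits M \<and> e \<in> C \<and> (\<forall>f\<in>C. (e, f) \<in> r)}"

definition minimal_broken_circuits :: "'e matroid \<Rightarrow> 'e rel \<Rightarrow> 'e set set" where
  "minimal_broken_circuits M r =
     {B \<in> broken_circuits M r. \<forall>B'\<in>broken_circuits M r. B' \<subseteq> B \<longrightarrow> B' = B}"


section \<open>Triangulations of simple polygons\<close>

text \<open>The plane is \<^typ>\<open>complex\<close>, and the straight line segment with endpoint set
  \<open>s = {a, b}\<close> is \<open>convex hull s = closed_segment a b\<close>. Distinct segments are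
  non-crossing if they have no common point other than a common endpoint.\<close>

definition noncrossing :: "complex set set \<Rightarrow> bool" where
  "noncrossing S \<longleftrightarrow>
     (\<forall>s\<in>S. \<forall>t\<in>S. s \<noteq> t \<longrightarrow> (convex hull s) \<inter> (convex hull t) = s \<inter> t)"

text \<open>A polygon is given by its vertices in cyclic order. The condition on the sides says
  that consecutive sides meet only in their common vertex and that other sides are disjoint.
  Straight angles at vertices are allowed.\<close>

definition simple_polygon :: "complex list \<Rightarrow> bool" where
  "simple_polygon vs \<longleftrightarrow> 3 \<le> length vs \<and> distinct vs \<and> noncrossing (cycle_edges vs)"

definition polygon_boundary :: "complex list \<Rightarrow> complex set" where
  "polygon_boundary vs = (\<Union>s\<in>cycle_edges vs. convex hull s)"

definition polygon_interior :: "complex list \<Rightarrow> complex set" where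
  "polygon_interior vs = inside (polygon_boundary vs)"

definition polygon_diagonals :: "complex list \<Rightarrow> complex set set" where
  "polygon_diagonals vs =
     {{a, b} | a b. a \<in> set vs \<and> b \<in> set vs \<and> a \<noteq> b \<and> {a, b} \<notin> cycle_edges vs
        \<and> open_segment a b \<subseteq> polygon_interior vs}"

text \<open>The diagonals in \<open>D\<close> partition the polygon into triangles: every piece into which they
  cut the interior is an open non-degenerate triangle whose sides are sides of the polygon or
  diagonals in \<open>D\<close>.\<close>

definition polygon_triangulation :: "complex list \<Rightarrow> complex set set \<Rightarrow> bool" where
  "polygon_triangulation vs D \<longleftrightarrow>
     D \<subseteq> polygon_diagonals vs \<and> noncrossing D \<and>
     (\<forall>T\<in>components (polygon_interior vs - (\<Union>d\<in>D. convex hull d)).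
        \<exists>a b c. \<not> collinear {a, b, c} \<and>
          {{a, b}, {b, c}, {c, a}} \<subseteq> cycle_edges vs \<union> D \<and>
          T = interior (convex hull {a, b, c}))"

definition triangulation_graph :: "complex list \<Rightarrow> complex set set \<Rightarrow> complex graph" where
  "triangulation_graph vs D = \<lparr>verts = set vs, edges = cycle_edges vs \<union> D\<rparr>"

end

theory Submission
  imports Defs
begin

text \<open>A triangulated polygon can be assembled from a single edge by repeatedly placing a new vertex
\<open>c\<close> on an existing edge \<open>{u, v}\<close> and adding the two edges \<open>{u, c}\<close> and \<open>{v, c}\<close>; such graphs
are called two-trees. Order the edges by the time at which they appear. In every cycle the
vertex that was added last has exactly two neighbours, so both of its two new edges lie in the
cycle, and the remaining edges of the cycle are smaller. Hence every broken circuit contains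
the pair of edges that came with some vertex. Each such pair is itself a broken circuit, because it
completes the edge on which the vertex was placed to a triangle. So the minimal broken circuits are
among these pairs, and the pairs are disjoint (\<open>two_tree_broken_circuits\<close>).

That a triangulated polygon is a two-tree (\<open>triangulated_polygon_two_tree\<close>) is shown by induction
on the number of vertices. A diagonal of the triangulation and the two boundary arcs between its
ends form a theta curve; by the Jordan curve theorem for theta curves the diagonal cuts the
interior into the interiors of two smaller polygons (\<open>split_polygon.interiors\<close>). Every other
diagonal and every triangle lies on one side by connectedness, so both parts
are triangulated (\<open>split_triangulation.half_triangulation\<close>), and two two-trees sharing exactly
one edge glue to a two-tree, provided that the construction of one of them can begin with that edge
(\<open>two_tree_glue\<close>). This is why the induction hypothesis allows an arbitrary side of the polygon as
the first edge. When there is no diagonal, the interior itself is an open triangle bounded by sides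
of the polygon, and a cycle with three mutually adjacent vertices has no further vertices
(\<open>cycle_with_triangle\<close>).\<close>

section \<open>Cycles as closed walks\<close>

text \<open>Recursion along the list makes it easy to cut a walk at a vertex. A cycle is the closed walk
that repeats its first vertex at the end, so cutting it at two vertices gives two paths, and
no modular index arithmetic is needed.\<close>

fun path_edges :: "'v list \<Rightarrow> 'v set set" where
  "path_edges (x # y # zs) = insert {x, y} (path_edges (y # zs))"
| "path_edges _ = {}"

lemma path_edges_nth: "path_edges xs = (\<lambda>i. {xs ! i, xs ! Suc i}) ` {..<length xs - 1}"
proof (induction xs rule: path_edges.induct)
  case (1 x y zs)
  have "{..<length (x # y # zs) - 1} = insert 0 (Suc ` {..<length (y # zs) - 1})"
    by (simp add: lessThan_Suc_eq_insert_0)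
  then show ?case by (simp only: path_edges.simps 1 image_insert image_image) simp
qed auto

lemma path_edges_append:
  "path_edges (xs @ z # ys) = path_edges (xs @ [z]) \<union> path_edges (z # ys)"
proof (induction xs)
  case (Cons x xs)
  then show ?case by (cases xs) auto
qed simp

lemma Union_path_edges: "\<Union> (path_edges xs) \<subseteq> set xs"
  by (induction xs rule: path_edges.induct) auto

lemma path_edges_subset: "s \<in> path_edges xs \<Longrightarrow> s \<subseteq> set xs"
  by (rule order_trans[OF Union_upper Union_path_edges])

lemma Union_path_edges_eq: "2 \<le> length xs \<Longrightarrow> \<Union> (path_edges xs) = set xs"
proof (induction xs rule: path_edges.induct)
  case (1 x y zs)
  then show ?case by (cases zs) auto
qed auto

lemma path_edges_pair:
  assumes "s \<in> path_edges xs" "distinct xs"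
  obtains p q where "s = {p, q}" "p \<noteq> q"
proof -
  from assms obtain i where i: "s = {xs ! i, xs ! Suc i}" "Suc i < length xs"
    unfolding path_edges_nth by fastforce
  then have "xs ! i \<noteq> xs ! Suc i" using assms(2) by (simp add: nth_eq_iff_index_eq)
  then show ?thesis using that i(1) by blast
qed

lemma cycle_edges_Cons: "cycle_edges (x # xs) = path_edges (x # xs @ [x])"
proof -
  let ?n = "Suc (length xs)"
  have "{(x # xs) ! i, (x # xs) ! (Suc i mod ?n)} = {(x # xs @ [x]) ! i, (x # xs @ [x]) ! Suc i}"
    if "i < ?n" for i
    using that by (cases "i = length xs"; cases i) (auto simp: nth_append nth_Cons')
  then have "(\<lambda>i. {(x # xs) ! i, (x # xs) ! (Suc i mod ?n)}) ` {..<?n} = path_edges (x # xs @ [x])"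
    unfolding path_edges_nth by (intro image_cong) auto
  moreover have "cycle_edges (x # xs) = (\<lambda>i. {(x # xs) ! i, (x # xs) ! (Suc i mod ?n)}) ` {..<?n}"
    unfolding cycle_edges_def setcompr_eq_image lessThan_def length_Cons ..
  ultimately show ?thesis by (simp only:)
qed

lemma cycle_edges_two_arcs:
  "cycle_edges (x # xs @ y # ys) = path_edges (x # xs @ [y]) \<union> path_edges (y # ys @ [x])"
  using path_edges_append[of "x # xs" y "ys @ [x]"] by (simp add: cycle_edges_Cons)

lemma cycle_edges_rotate: "cycle_edges (xs @ ys) = cycle_edges (ys @ xs)"
  by (cases xs; cases ys) (auto simp: cycle_edges_two_arcs)

lemma cycle_edges_close:
  "cycle_edges (x # xs @ [y]) = insert {x, y} (path_edges (x # xs @ [y]))"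
  using cycle_edges_two_arcs[of x xs y "[]"] by (simp add: insert_commute)

lemma cycle_edges_subset: "s \<in> cycle_edges vs \<Longrightarrow> s \<subseteq> set vs"
  by (cases vs) (auto simp: cycle_edges_Cons cycle_edges_def[of "[]"] dest!: path_edges_subset)

lemma Union_cycle_edges: "\<Union> (cycle_edges vs) = set vs"
proof (cases vs)
  case (Cons x xs)
  have "\<Union> (path_edges (x # xs @ [x])) = set (x # xs @ [x])" by (rule Union_path_edges_eq) simp
  then show ?thesis by (simp add: Cons cycle_edges_Cons)
qed (simp add: cycle_edges_def)

lemma ends_not_adjacent:
  assumes "distinct (x # xs @ [y])" "xs \<noteq> []"
  shows "{x, y} \<notin> path_edges (x # xs @ [y])"
proof -
  obtain z zs where xs: "xs = z # zs" using assms(2) by (cases xs) auto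
  have "{x, y} \<notin> path_edges (z # zs @ [y])"
    using path_edges_subset[of "{x, y}" "z # zs @ [y]"] assms xs by auto
  then show ?thesis using assms xs by (auto simp: doubleton_eq_iff)
qed

text \<open>Rotating the list so that \<open>c\<close> comes first exhibits the neighbours \<open>p\<close> and \<open>q\<close> of \<open>c\<close> on the
cycle as the ends of the remaining path.\<close>

lemma cycle_start_at:
  assumes "3 \<le> length xs" "distinct xs" "c \<in> set xs"
  obtains p qs q where "distinct (c # p # qs @ [q])" "cycle_edges xs = cycle_edges (c # p # qs @ [q])"
proof -
  obtain as bs where s: "xs = as @ c # bs" using assms(3) by (meson split_list)
  let ?ys = "bs @ as"
  have ys: "2 \<le> length ?ys" "distinct (c # ?ys)" using assms s by auto
  obtain p zs where pz: "?ys = p # zs" using ys(1) by (cases ?ys) auto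
  obtain qs q where q: "zs = qs @ [q]" using ys(1) pz by (cases zs rule: rev_cases) auto
  have "cycle_edges xs = cycle_edges (c # p # qs @ [q])"
    using cycle_edges_rotate[of as "c # bs"] pz q s by simp
  then show ?thesis using that ys(2) pz q by simp
qed

lemma cycle_edges_at:
  "cycle_edges (c # p # qs @ [q]) = {{p, c}, {q, c}} \<union> path_edges (p # qs @ [q])"
  using cycle_edges_close[of c "p # qs" q] by (auto simp: insert_commute)

lemma is_cycle_through:
  assumes "is_cycle G xs" "c \<in> set xs"
  obtains p q R where "cycle_edges xs = {{p, c}, {q, c}} \<union> R" "p \<noteq> q" "R \<noteq> {}"
    "c \<notin> \<Union> R" "p \<noteq> c" "q \<noteq> c"
proof -
  obtain p qs q where d: "distinct (c # p # qs @ [q])"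
    and E: "cycle_edges xs = cycle_edges (c # p # qs @ [q])"
    using cycle_start_at[of xs c] assms by (auto simp: is_cycle_def)
  have "path_edges (p # qs @ [q]) \<noteq> {}" by (cases qs) auto
  moreover have "c \<notin> \<Union> (path_edges (p # qs @ [q]))"
    using Union_path_edges[of "p # qs @ [q]"] d by auto
  ultimately show ?thesis using that[OF E[unfolded cycle_edges_at]] d by auto
qed

text \<open>The vertices \<open>b\<close> and \<open>c\<close> must be the two neighbours of \<open>a\<close> on the cycle. They are the ends of
the path that remains without \<open>a\<close>, and the ends of a path are adjacent only if the path has no inner
vertex.\<close>

lemma cycle_with_triangle:
  assumes vs: "3 \<le> length vs" "distinct vs" and abc: "a \<noteq> b" "b \<noteq> c" "c \<noteq> a"
    "{{a, b}, {b, c}, {c, a}} \<subseteq> cycle_edges vs"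
  obtains p q where "distinct [a, p, q]" "cycle_edges vs = cycle_edges [a, p, q]"
proof -
  have "a \<in> set vs" using abc(4) cycle_edges_subset[of "{a, b}" vs] by auto
  then obtain p qs q where d: "distinct (a # p # qs @ [q])"
    and E: "cycle_edges vs = cycle_edges (a # p # qs @ [q])"
    using cycle_start_at[OF vs] by metis
  let ?R = "path_edges (p # qs @ [q])"
  have "a \<notin> set (p # qs @ [q])" using d by simp
  then have "{a, b} \<notin> ?R" "{c, a} \<notin> ?R"
    using path_edges_subset[of "{a, b}" "p # qs @ [q]"] path_edges_subset[of "{c, a}" "p # qs @ [q]"]
    by blast+
  moreover have abc': "{a, b} \<in> {{p, a}, {q, a}} \<union> ?R" "{c, a} \<in> {{p, a}, {q, a}} \<union> ?R"
    "{b, c} \<in> {{p, a}, {q, a}} \<union> ?R"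
    using abc(4) unfolding E cycle_edges_at by (simp_all only: insert_subset)
  ultimately have "{a, b} = {p, a} \<or> {a, b} = {q, a}" "{c, a} = {p, a} \<or> {c, a} = {q, a}"
    by simp_all
  then have "b \<in> {p, q}" "c \<in> {p, q}" using abc(1,3) by (auto simp: doubleton_eq_iff)
  then have "{b, c} = {p, q}" using abc(2) by auto
  moreover have "{b, c} \<in> ?R"
    using abc'(3) abc(1,3) by (auto simp: doubleton_eq_iff)
  ultimately have "{p, q} \<in> ?R" by simp
  then have "qs = []" using ends_not_adjacent[of p qs q] d by auto
  then show ?thesis using that[of p q] d E by simp
qed

section \<open>Two-trees\<close>

text \<open>The two-trees with vertex set \<open>V\<close> and edge set \<open>E\<close> whose construction begins with the edge \<open>e\<close>.
The first edge is recorded because two two-trees are glued along it.\<close>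

inductive two_tree :: "'v set \<Rightarrow> 'v set \<Rightarrow> 'v set set \<Rightarrow> bool" for e where
  root: "\<lbrakk>e = {u, v}; u \<noteq> v\<rbrakk> \<Longrightarrow> two_tree e e {e}"
| cone: "\<lbrakk>two_tree e V E; {u, v} \<in> E; u \<noteq> v; c \<notin> V\<rbrakk>
    \<Longrightarrow> two_tree e (insert c V) (E \<union> {{u, c}, {v, c}})"

lemma two_tree_edges: "two_tree e V E \<Longrightarrow> \<Union> E \<subseteq> V"
  by (induction rule: two_tree.induct) auto

text \<open>The construction of the second two-tree begins with \<open>d\<close>, and its other vertices do not belong to
the first one. So the same construction steps can be carried out with the first two-tree in
place of \<open>d\<close>.\<close>

lemma two_tree_glue:
  assumes F: "two_tree d W F" and E: "two_tree e V E" "d \<in> E" and VW: "V \<inter> W = d"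
  shows "two_tree e (V \<union> W) (E \<union> F)"
  using F VW
proof (induction rule: two_tree.induct)
  case (root u v)
  then have "V \<union> d = V" "E \<union> {d} = E" using E(2) two_tree_edges[OF E(1)] by auto
  then show ?case using E(1) by simp
next
  case (cone W F u v c)
  have "d \<subseteq> V" using two_tree_edges[OF E(1)] E(2) by blast
  have "d \<subseteq> W" using cone(1)
    by (induction rule: two_tree.induct) auto
  then have "V \<inter> W = d" "c \<notin> V" using cone by auto
  then have "two_tree e (insert c (V \<union> W)) (E \<union> F \<union> {{u, c}, {v, c}})"
    using cone by (intro two_tree.cone) auto
  then show ?case by (simp add: Un_assoc)
qed

lemma two_tree_triangle:
  assumes "distinct [a, b, c]" "e \<in> cycle_edges [a, b, c]"
  shows "two_tree e {a, b, c} (cycle_edges [a, b, c])"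
proof -
  have ce: "cycle_edges [a, b, c] = {{a, b}, {b, c}, {a, c}}"
    by (simp add: cycle_edges_Cons insert_commute)
  have *: "two_tree {p, q} {p, q, r} {{p, q}, {q, r}, {p, r}}" if "distinct [p, q, r]" for p q r :: 'a
    using two_tree.cone[OF two_tree.root[of "{p,q}" p q], of p q r] that
    by (auto simp: insert_commute)
  consider "e = {a, b}" | "e = {b, c}" | "e = {a, c}" using assms ce by auto
  then show ?thesis
    using *[of a b c] *[of b c a] *[of a c b] assms(1) ce
    by cases (auto simp: insert_commute)
qed

section \<open>Ordering the edges of a two-tree\<close>

definition linear_extension :: "'e rel \<Rightarrow> 'e set \<Rightarrow> 'e \<Rightarrow> 'e \<Rightarrow> 'e rel" where
  "linear_extension r A p q = r \<union> A \<times> {p, q} \<union> {(p, p), (p, q), (q, q)}"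

lemma linear_order_linear_extension:
  assumes "linear_order_on A r" "p \<notin> A" "q \<notin> A" "p \<noteq> q"
  shows "linear_order_on (A \<union> {p, q}) (linear_extension r A p q)"
proof -
  have r: "r \<subseteq> A \<times> A" "refl_on A r" "trans r" "antisym r" "total_on A r"
    using assms(1) by (auto simp: linear_order_on_def partial_order_on_def preorder_on_def)
  show ?thesis
    unfolding linear_order_on_def partial_order_on_def preorder_on_def
  proof (intro conjI)
    show "linear_extension r A p q \<subseteq> (A \<union> {p, q}) \<times> (A \<union> {p, q})"
      using r(1) by (auto simp: linear_extension_def)
    show "refl_on (A \<union> {p, q}) (linear_extension r A p q)"
      using r(2) by (auto simp: linear_extension_def refl_on_def)
    show "trans (linear_extension r A p q)"
      using r(1,3) assms(2,3) unfolding trans_def linear_extension_def by blast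
    show "antisym (linear_extension r A p q)"
      using r(1,4) assms(2-4) unfolding antisym_def linear_extension_def by blast
    show "total_on (A \<union> {p, q}) (linear_extension r A p q)"
      using r(5) unfolding total_on_def linear_extension_def by blast
  qed
qed

lemma broken_circuitI:
  assumes "is_cycle G xs" "e \<in> cycle_edges xs" "\<And>f. f \<in> cycle_edges xs \<Longrightarrow> (e, f) \<in> r"
  shows "cycle_edges xs - {e} \<in> broken_circuits (cycle_matroid G) r"
  unfolding broken_circuits_def cycle_matroid_def using assms
  by (intro CollectI exI[of _ "cycle_edges xs"] exI[of _ e]) auto

lemma broken_circuitE:
  assumes "B \<in> broken_circuits (cycle_matroid G) r"
  obtains xs e where "B = cycle_edges xs - {e}" "is_cycle G xs" "e \<in> cycle_edges xs"
    "\<forall>f\<in>cycle_edges xs. (e, f) \<in> r"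
  using assms unfolding broken_circuits_def cycle_matroid_def by auto

lemma broken_circuits_subset:
  "B \<in> broken_circuits (cycle_matroid G) r \<Longrightarrow> B \<subseteq> edges G"
  by (erule broken_circuitE) (auto simp: is_cycle_def)

text \<open>Placing a vertex \<open>c\<close> on \<open>{u, v}\<close> puts the new edges \<open>{u, c}\<close> and \<open>{v, c}\<close> on top of the order.
The old cycles keep their smallest element. A cycle through \<open>c\<close> contains both new edges together
with at least one old, hence smaller, edge, so its broken circuit contains the new pair. The triangle
\<open>u, v, c\<close> yields exactly this pair, which is added to the family \<open>P\<close>.\<close>

lemma two_tree_broken_circuits:
  assumes "two_tree e V E"
  shows "\<exists>r P. linear_order_on E r
    \<and> P \<subseteq> broken_circuits (cycle_matroid \<lparr>verts = V, edges = E\<rparr>) r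
    \<and> pairwise disjnt P
    \<and> (\<forall>B\<in>broken_circuits (cycle_matroid \<lparr>verts = V, edges = E\<rparr>) r. \<exists>A\<in>P. A \<subseteq> B)"
  using assms
proof (induction rule: two_tree.induct)
  case (root u v)
  have "linear_order_on {e} {(e, e)}"
    by (auto simp: linear_order_on_def partial_order_on_def preorder_on_def refl_on_def
        trans_def antisym_def total_on_def)
  moreover have "\<not> is_cycle \<lparr>verts = e, edges = {e}\<rparr> xs" for xs
  proof
    assume "is_cycle \<lparr>verts = e, edges = {e}\<rparr> xs"
    then have "3 \<le> card (set xs)" "set xs \<subseteq> {u, v}"
      using root by (auto simp: is_cycle_def distinct_card)
    then show False using card_mono[of "{u, v}" "set xs"] card_insert_le_m1[of 2 "{v}" u] by auto
  qed
  ultimately show ?case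
    by (intro exI[of _ "{(e, e)}"] exI[of _ "{}"])
      (auto simp: broken_circuits_def cycle_matroid_def)
next
  case (cone V E u v c)
  let ?G = "\<lparr>verts = V, edges = E\<rparr>"
  let ?p = "{u, c}" and ?q = "{v, c}"
  let ?G' = "\<lparr>verts = insert c V, edges = E \<union> {?p, ?q}\<rparr>"
  obtain r P where r: "linear_order_on E r" and P: "P \<subseteq> broken_circuits (cycle_matroid ?G) r"
    "pairwise disjnt P" "\<forall>B\<in>broken_circuits (cycle_matroid ?G) r. \<exists>A\<in>P. A \<subseteq> B"
    using cone.IH by blast
  have EV: "\<Union> E \<subseteq> V" by (rule two_tree_edges[OF cone(1)])
  then have uv: "u \<in> V" "v \<in> V" "u \<noteq> c" "v \<noteq> c" using cone by auto
  have new: "?p \<notin> E" "?q \<notin> E" "?p \<noteq> ?q"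
    using EV cone uv by (auto simp: doubleton_eq_iff)
  define r' where "r' = linear_extension r E ?p ?q"
  have rE: "r \<subseteq> E \<times> E"
    using r by (auto simp: linear_order_on_def partial_order_on_def preorder_on_def)
  have old: "is_cycle ?G xs" if "is_cycle ?G' xs" "c \<notin> set xs" for xs
    using that unfolding is_cycle_def using cycle_edges_subset[of _ xs] by fastforce
  have mono: "is_cycle ?G' xs" if "is_cycle ?G xs" for xs
    using that by (auto simp: is_cycle_def)
  \<comment> \<open>The new vertex has degree two, so a cycle through it uses both of its edges.\<close>
  have thru: "?p \<in> cycle_edges xs \<and> ?q \<in> cycle_edges xs \<and> cycle_edges xs \<inter> E \<noteq> {}"
    if xs: "is_cycle ?G' xs" and c: "c \<in> set xs" for xs
  proof -
    obtain x y R where R: "cycle_edges xs = {{x, c}, {y, c}} \<union> R" "x \<noteq> y" "R \<noteq> {}"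
      "c \<notin> \<Union> R" "x \<noteq> c" "y \<noteq> c"
      using is_cycle_through[OF xs c] by metis
    have "cycle_edges xs \<subseteq> E \<union> {?p, ?q}" using xs by (simp add: is_cycle_def)
    moreover have "{x, c} \<notin> E" "{y, c} \<notin> E" using EV cone(4) by auto
    ultimately have "{x, c} \<in> {?p, ?q}" "{y, c} \<in> {?p, ?q}" "R \<subseteq> E"
      using R(1,4) by auto
    then have "{{x, c}, {y, c}} = {?p, ?q}" "R \<subseteq> E"
      using R(2,5,6) uv by (auto simp: doubleton_eq_iff)
    then have "cycle_edges xs = {?p, ?q} \<union> R" "R \<subseteq> E" using R(1) by simp_all
    then show ?thesis using R(3) by auto
  qed
  have tri: "cycle_edges [u, v, c] = {{u, v}, ?p, ?q}"
    by (auto simp: cycle_edges_Cons insert_commute)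
  have "is_cycle ?G' [u, v, c]"
    using uv cone by (simp add: is_cycle_def tri) 
  moreover have "({u, v}, f) \<in> r'" if "f \<in> cycle_edges [u, v, c]" for f
    using that r cone(2) unfolding tri r'_def linear_extension_def
    by (auto simp: linear_order_on_def partial_order_on_def preorder_on_def refl_on_def)
  ultimately have "cycle_edges [u, v, c] - {{u, v}} \<in> broken_circuits (cycle_matroid ?G') r'"
    by (intro broken_circuitI) (auto simp: tri)
  moreover have "{?p, ?q} = cycle_edges [u, v, c] - {{u, v}}"
    using new cone(2) unfolding tri by auto
  ultimately have "{?p, ?q} \<in> broken_circuits (cycle_matroid ?G') r'" by simp
  moreover have "A \<in> broken_circuits (cycle_matroid ?G') r'" if "A \<in> P" for A
  proof -
    have "A \<in> broken_circuits (cycle_matroid ?G) r" using that P(1) by blast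
    then obtain xs m where A: "A = cycle_edges xs - {m}" "is_cycle ?G xs" "m \<in> cycle_edges xs"
      "\<forall>f\<in>cycle_edges xs. (m, f) \<in> r"
      by (rule broken_circuitE)
    show ?thesis
      unfolding A(1) using A(3,4) mono[OF A(2)]
      by (intro broken_circuitI) (auto simp: r'_def linear_extension_def)
  qed
  moreover have "linear_order_on (E \<union> {?p, ?q}) r'"
    unfolding r'_def using linear_order_linear_extension[OF r new] .
  moreover have "pairwise disjnt (insert {?p, ?q} P)"
  proof -
    have "disjnt {?p, ?q} A" if "A \<in> P" for A
      using broken_circuits_subset[of A ?G r] that P(1) new by (auto simp: disjnt_def)
    then show ?thesis using P(2) by (auto simp: pairwise_insert disjnt_sym)
  qed
  moreover have "\<exists>A\<in>insert {?p, ?q} P. A \<subseteq> B"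
    if B_broken: "B \<in> broken_circuits (cycle_matroid ?G') r'" for B
  proof -
    obtain xs m where B: "B = cycle_edges xs - {m}" "is_cycle ?G' xs" "m \<in> cycle_edges xs"
      "\<forall>f\<in>cycle_edges xs. (m, f) \<in> r'"
      by (rule broken_circuitE[OF B_broken])
    show ?thesis
    proof (cases "c \<in> set xs")
      case True
      then obtain f where "f \<in> cycle_edges xs" "f \<in> E" using thru B(2) by blast
      then have "(m, f) \<in> r'" "f \<in> E" using B(4) by auto
      then have "m \<noteq> ?p" "m \<noteq> ?q"
        using new rE by (auto simp: r'_def linear_extension_def)
      then have "{?p, ?q} \<subseteq> B" using thru[OF B(2) True] B(1) by simp
      then show ?thesis by blast
    next
      case False
      then have xs: "is_cycle ?G xs" using old B by simp
      then have "cycle_edges xs \<subseteq> E" by (simp add: is_cycle_def)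
      then have "(m, f) \<in> r" if "f \<in> cycle_edges xs" for f
        using bspec[OF B(4) that] new that by (auto simp: r'_def linear_extension_def)
      then have "B \<in> broken_circuits (cycle_matroid ?G) r"
        unfolding B(1) using B(3) xs by (intro broken_circuitI)
      then show ?thesis using P(3) by blast
    qed
  qed
  ultimately show ?case
    by (intro exI[of _ r'] exI[of _ "insert {?p, ?q} P"] conjI ballI insert_subsetI subsetI)
      (simp_all only:)
qed

lemma two_tree_minimal_broken_circuits:
  assumes "two_tree e V E"
  shows "\<exists>r. linear_order_on E r \<and>
    pairwise disjnt (minimal_broken_circuits (cycle_matroid \<lparr>verts = V, edges = E\<rparr>) r)"
proof -
  obtain r P where r: "linear_order_on E r"
    and P: "P \<subseteq> broken_circuits (cycle_matroid \<lparr>verts = V, edges = E\<rparr>) r" "pairwise disjnt P"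
    "\<forall>B\<in>broken_circuits (cycle_matroid \<lparr>verts = V, edges = E\<rparr>) r. \<exists>A\<in>P. A \<subseteq> B"
    using two_tree_broken_circuits[OF assms] by (elim exE conjE)
  have "minimal_broken_circuits (cycle_matroid \<lparr>verts = V, edges = E\<rparr>) r \<subseteq> P"
  proof
    fix B assume "B \<in> minimal_broken_circuits (cycle_matroid \<lparr>verts = V, edges = E\<rparr>) r"
    then have B: "B \<in> broken_circuits (cycle_matroid \<lparr>verts = V, edges = E\<rparr>) r"
      and min: "\<And>A. A \<in> broken_circuits (cycle_matroid \<lparr>verts = V, edges = E\<rparr>) r \<Longrightarrow> A \<subseteq> B \<Longrightarrow> A = B"
      unfolding minimal_broken_circuits_def by simp_all
    obtain A where "A \<in> P" "A \<subseteq> B" using bspec[OF P(3) B] by (elim bexE)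
    then show "B \<in> P" using min[of A] subsetD[OF P(1)] by simp
  qed
  then show ?thesis using r P(2) pairwise_subset by metis
qed

section \<open>Simple polygons\<close>

lemma finite_cycle_edges: "finite (cycle_edges vs)"
  by (auto simp: cycle_edges_def)

lemma closed_polygon_boundary: "closed (polygon_boundary vs)"
  unfolding polygon_boundary_def
proof (intro closed_UN finite_cycle_edges ballI compact_imp_closed)
  fix s assume "s \<in> cycle_edges vs"
  then have "finite s" by (meson cycle_edges_subset finite_set finite_subset)
  then show "compact (convex hull s)" by (simp add: finite_imp_compact_convex_hull)
qed

lemma open_polygon_interior: "open (polygon_interior vs)"
  unfolding polygon_interior_def by (rule open_inside[OF closed_polygon_boundary])

lemma closure_polygon_interior: "closure (polygon_interior vs) \<subseteq> polygon_boundary vs \<union> polygon_interior vs"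
  unfolding polygon_interior_def by (rule closure_inside_subset[OF closed_polygon_boundary])

lemma interior_boundary_disjoint: "polygon_interior vs \<inter> polygon_boundary vs = {}"
  unfolding polygon_interior_def by simp

lemma side_in_boundary: "s \<in> cycle_edges vs \<Longrightarrow> convex hull s \<subseteq> polygon_boundary vs"
  unfolding polygon_boundary_def by (rule UN_upper)

lemma subset_convex_hull: "s \<subseteq> convex hull s"
  by (rule hull_subset)

lemma vertex_in_boundary: "set vs \<subseteq> polygon_boundary vs"
  unfolding polygon_boundary_def Union_cycle_edges[of vs, symmetric] using subset_convex_hull by blast

lemma hull_minus_ends: "u \<noteq> v \<Longrightarrow> convex hull {u, v} - {u, v} = open_segment u v"
  by (simp add: segment_convex_hull[symmetric] open_segment_def)

lemma noncrossingD:
  "noncrossing S \<Longrightarrow> s \<in> S \<Longrightarrow> t \<in> S \<Longrightarrow> s \<noteq> t \<Longrightarrow> convex hull s \<inter> convex hull t = s \<inter> t"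
  by (simp add: noncrossing_def)

lemma noncrossing_subset: "noncrossing S \<Longrightarrow> T \<subseteq> S \<Longrightarrow> noncrossing T"
  by (meson noncrossing_def subsetD)

text \<open>A vertex is an end of some side, and two distinct sides meet only in common ends.\<close>

lemma vertex_on_side:
  assumes "simple_polygon vs" "v \<in> set vs" "s \<in> cycle_edges vs" "v \<in> convex hull s"
  shows "v \<in> s"
proof (rule ccontr)
  assume "v \<notin> s"
  obtain t where t: "t \<in> cycle_edges vs" "v \<in> t" using assms(2) Union_cycle_edges[of vs] by blast
  then have "v \<in> convex hull s \<inter> convex hull t" "s \<noteq> t"
    using assms(4) subset_convex_hull[of t] \<open>v \<notin> s\<close> by auto
  then show False
    using noncrossingD[of "cycle_edges vs" s t] assms(1,3) t(1) \<open>v \<notin> s\<close>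
    by (auto simp: simple_polygon_def)
qed

lemma polygonal_arc:
  assumes "2 \<le> length xs" "distinct xs" "noncrossing (path_edges xs)"
  shows "\<exists>g. arc g \<and> pathstart g = hd xs \<and> pathfinish g = last xs \<and>
    path_image g = (\<Union>s\<in>path_edges xs. convex hull s)"
  using assms
proof (induction xs rule: path_edges.induct)
  case (1 x y zs)
  show ?case
  proof (cases "zs = []")
    case True
    then show ?thesis using 1
      by (intro exI[of _ "linepath x y"]) (auto simp: segment_convex_hull)
  next
    case False
    have "noncrossing (path_edges (y # zs))"
      using 1(4) by (rule noncrossing_subset) auto
    then obtain g where g: "arc g" "pathstart g = y" "pathfinish g = last (y # zs)"
      "path_image g = (\<Union>s\<in>path_edges (y # zs). convex hull s)"
      using 1 False by (auto simp: Suc_le_eq)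
    have "convex hull {x, y} \<inter> convex hull s \<subseteq> {y}" if s: "s \<in> path_edges (y # zs)" for s
    proof -
      have "x \<notin> s" using path_edges_subset[OF s] 1(3) by auto
      then show ?thesis
        using noncrossingD[OF 1(4), of "{x, y}" s] s by auto
    qed
    then have "path_image (linepath x y) \<inter> path_image g \<subseteq> {pathstart g}"
      by (auto simp: g segment_convex_hull)
    then have "arc (linepath x y +++ g)"
      using g 1(3) by (intro arc_join) auto
    moreover have "path_image (linepath x y +++ g) = (\<Union>s\<in>path_edges (x # y # zs). convex hull s)"
      by (subst path_image_join) (auto simp: g segment_convex_hull)
    ultimately show ?thesis
      using g by (intro exI[of _ "linepath x y +++ g"]) auto
  qed
qed auto

text \<open>The boundary is a simple closed curve: the polygonal arc through all vertices, closed up by the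
last side. The Jordan curve theorem applies.\<close>

lemma polygon_interior_nonempty:
  assumes "simple_polygon vs"
  shows "polygon_interior vs \<noteq> {}"
proof -
  have len: "3 \<le> length vs" "distinct vs" "noncrossing (cycle_edges vs)"
    using assms by (auto simp: simple_polygon_def)
  obtain x ws where ws: "vs = x # ws" using len by (cases vs) auto
  obtain xs y where xs: "ws = xs @ [y]" using len ws by (cases ws rule: rev_cases) auto
  have vs: "vs = x # xs @ [y]" and "xs \<noteq> []" using ws xs len by auto
  have ce: "cycle_edges vs = insert {x, y} (path_edges vs)"
    unfolding vs by (rule cycle_edges_close)
  have "noncrossing (path_edges vs)"
    using len(3) by (rule noncrossing_subset) (simp add: ce subset_insertI)
  then obtain g where g: "arc g" "pathstart g = x" "pathfinish g = y"
    "path_image g = (\<Union>s\<in>path_edges vs. convex hull s)"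
    using polygonal_arc[of vs] len vs by auto
  have "{x, y} \<notin> path_edges vs"
    using len(2) vs ends_not_adjacent[of x xs y] \<open>xs \<noteq> []\<close> by auto
  then have "convex hull s \<inter> convex hull {x, y} \<subseteq> {x, y}" if "s \<in> path_edges vs" for s
    using noncrossingD[OF len(3), of s "{x, y}"] that unfolding ce by auto
  then have "path_image g \<inter> path_image (linepath y x) \<subseteq> {pathstart g, pathstart (linepath y x)}"
    by (auto simp: g segment_convex_hull insert_commute)
  then have "simple_path (g +++ linepath y x)"
    using g len(2) vs by (intro simple_path_join_loop) auto
  moreover have "path_image (g +++ linepath y x) = polygon_boundary vs"
    using g by (subst path_image_join)
      (auto simp: polygon_boundary_def ce segment_convex_hull insert_commute)
  moreover have "pathfinish (g +++ linepath y x) = pathstart (g +++ linepath y x)"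
    using g by simp
  ultimately show ?thesis
    using Jordan_inside_outside[of "g +++ linepath y x"] by (simp add: polygon_interior_def)
qed

text \<open>Rotating the vertex list of a polygon does not change its sides; everything else about the polygon is
determined by them.\<close>

lemma polygon_cong:
  assumes "cycle_edges vs = cycle_edges ws"
  shows "set vs = set ws" "polygon_boundary vs = polygon_boundary ws"
    "polygon_interior vs = polygon_interior ws" "polygon_diagonals vs = polygon_diagonals ws"
    "polygon_triangulation vs D \<longleftrightarrow> polygon_triangulation ws D"
proof -
  show s: "set vs = set ws"
    using assms by (metis Union_cycle_edges)
  show "polygon_boundary vs = polygon_boundary ws" by (simp add: polygon_boundary_def assms)
  then show i: "polygon_interior vs = polygon_interior ws" by (simp add: polygon_interior_def)
  show d: "polygon_diagonals vs = polygon_diagonals ws"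
    by (simp add: polygon_diagonals_def assms s i)
  show "polygon_triangulation vs D \<longleftrightarrow> polygon_triangulation ws D"
    by (simp add: polygon_triangulation_def assms i d)
qed

section \<open>Cutting a polygon along a diagonal\<close>

text \<open>The vertex list is taken to begin at one end of the diagonal. Reading it from the other end
exchanges the two parts (\<open>swap\<close> below), so facts about \<open>half\<close> transfer to the other
part.\<close>

locale split_polygon =
  fixes a b :: complex and xs ys :: "complex list"
  assumes simple: "simple_polygon (a # xs @ b # ys)"
    and diagonal: "{a, b} \<in> polygon_diagonals (a # xs @ b # ys)"
begin

abbreviation "whole \<equiv> a # xs @ b # ys"
abbreviation "half \<equiv> a # xs @ [b]"
abbreviation "other \<equiv> b # ys @ [a]"

lemma swap: "split_polygon b a ys xs"
proof
  have *: "cycle_edges (b # ys @ a # xs) = cycle_edges whole"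
    using cycle_edges_rotate[of "a # xs" "b # ys"] by simp
  show "simple_polygon (b # ys @ a # xs)"
    using simple unfolding simple_polygon_def * by auto
  show "{b, a} \<in> polygon_diagonals (b # ys @ a # xs)"
    using diagonal polygon_cong(4)[OF *] by (simp add: insert_commute)
qed

lemma distinct: "distinct whole" and sides_noncrossing: "noncrossing (cycle_edges whole)"
  using simple by (auto simp: simple_polygon_def)

lemma whole_sides: "cycle_edges whole = path_edges half \<union> path_edges other"
  by (rule cycle_edges_two_arcs)

lemma half_sides: "cycle_edges half = insert {a, b} (path_edges half)"
  by (rule cycle_edges_close)

lemma other_sides: "cycle_edges other = insert {a, b} (path_edges other)"
  by (simp add: cycle_edges_close insert_commute)

lemma not_side: "{a, b} \<notin> cycle_edges whole" and segment_interior: "open_segment a b \<subseteq> polygon_interior whole"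
proof -
  obtain u v where uv: "{a, b} = {u, v}" "{u, v} \<notin> cycle_edges whole"
    "open_segment u v \<subseteq> polygon_interior whole"
    using diagonal unfolding polygon_diagonals_def by blast
  show "{a, b} \<notin> cycle_edges whole" using uv(1,2) by simp
  have same: "open_segment a b = open_segment u v"
    using uv(1) by (auto simp: doubleton_eq_iff open_segment_commute)
  show "open_segment a b \<subseteq> polygon_interior whole" unfolding same by (rule uv(3))
qed

lemma xs_nonempty: "xs \<noteq> []"
proof
  assume "xs = []"
  then have "{a, b} \<in> path_edges half" by simp
  then show False using not_side unfolding whole_sides by blast
qed

lemma ys_nonempty: "ys \<noteq> []"
  by (rule split_polygon.xs_nonempty[OF swap])

lemma hull_diagonal: "convex hull {a, b} = open_segment a b \<union> {a, b}"
  by (simp add: segment_convex_hull[symmetric] closed_segment_eq_open)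

lemma side_meets_diagonal:
  assumes "s \<in> cycle_edges whole"
  shows "convex hull s \<inter> convex hull {a, b} = s \<inter> {a, b}"
proof -
  have "convex hull s \<inter> open_segment a b = {}"
    using side_in_boundary[OF assms] segment_interior interior_boundary_disjoint[of whole] by blast
  moreover have "v \<in> s" if "v \<in> {a, b}" "v \<in> convex hull s" for v
    using that by (intro vertex_on_side[OF simple _ assms]) auto
  ultimately show ?thesis using subset_convex_hull[of s] unfolding hull_diagonal by blast
qed

lemma half_simple: "simple_polygon half"
proof -
  have "noncrossing (insert {a, b} (path_edges half))"
    unfolding noncrossing_def
  proof (intro ballI impI)
    fix s t assume st: "s \<in> insert {a, b} (path_edges half)" "t \<in> insert {a, b} (path_edges half)" "s \<noteq> t"
    consider "s = {a, b}" "t \<in> cycle_edges whole" | "t = {a, b}" "s \<in> cycle_edges whole"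
      | "s \<in> cycle_edges whole" "t \<in> cycle_edges whole"
      using st by (auto simp: whole_sides)
    then show "convex hull s \<inter> convex hull t = s \<inter> t"
    proof cases
      case 1
      then show ?thesis using side_meets_diagonal[of t] by (simp add: Int_commute)
    next
      case 2
      then show ?thesis using side_meets_diagonal[of s] by simp
    next
      case 3
      then show ?thesis by (intro noncrossingD[OF sides_noncrossing] st(3))
    qed
  qed
  then show ?thesis
    using distinct xs_nonempty unfolding simple_polygon_def half_sides
    by (cases xs) auto
qed

lemma half_boundary:
  "polygon_boundary half = (\<Union>s\<in>path_edges half. convex hull s) \<union> closed_segment a b"
  unfolding polygon_boundary_def half_sides by (simp add: Un_commute segment_convex_hull)

text \<open>A common point of the two arcs comes from a side \<open>s\<close> of one and a side \<open>t\<close> of the other. The vertex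
lists share only \<open>a\<close> and \<open>b\<close>, so \<open>s = t\<close> would make the diagonal a side; distinct sides
meet only in common ends.\<close>

lemma arcs_meet:
  "(\<Union>s\<in>path_edges half. convex hull s) \<inter> (\<Union>s\<in>path_edges other. convex hull s) = {a, b}"
  (is "?L \<inter> ?R = _")
proof
  show "{a, b} \<subseteq> ?L \<inter> ?R"
  proof -
    have "\<Union> (path_edges half) = set half" "\<Union> (path_edges other) = set other"
      by (rule Union_path_edges_eq; simp)+
    then have "set half \<subseteq> ?L" "set other \<subseteq> ?R" using subset_convex_hull by blast+
    then show ?thesis by auto
  qed
  show "?L \<inter> ?R \<subseteq> {a, b}"
  proof
    fix z assume "z \<in> ?L \<inter> ?R"
    then obtain s t where st: "s \<in> path_edges half" "t \<in> path_edges other"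
      "z \<in> convex hull s \<inter> convex hull t" by blast
    have "set half \<inter> set other = {a, b}" using distinct by auto
    then have ab: "s \<inter> t \<subseteq> {a, b}" using path_edges_subset[OF st(1)] path_edges_subset[OF st(2)] by blast
    have "s \<noteq> t"
    proof
      assume "s = t"
      obtain p q where "s = {p, q}" "p \<noteq> q"
        using path_edges_pair[OF st(1)] distinct by auto
      then have "s = {a, b}" using ab \<open>s = t\<close> by (auto simp: doubleton_eq_iff)
      then show False using st(1) not_side whole_sides by blast
    qed
    then have "convex hull s \<inter> convex hull t = s \<inter> t"
      using st by (intro noncrossingD[OF sides_noncrossing]) (auto simp: whole_sides)
    then show "z \<in> {a, b}" using st(3) ab by blast
  qed
qed

lemma arc_meets_diagonal:
  "(\<Union>s\<in>path_edges half. convex hull s) \<inter> closed_segment a b = {a, b}" (is "?L \<inter> _ = _")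
proof -
  have "convex hull s \<inter> closed_segment a b = s \<inter> {a, b}" if "s \<in> path_edges half" for s
    using side_meets_diagonal[of s] that by (simp add: whole_sides segment_convex_hull)
  then have "?L \<inter> closed_segment a b = \<Union> (path_edges half) \<inter> {a, b}"
    by auto
  also have "\<Union> (path_edges half) = set half" by (rule Union_path_edges_eq) simp
  finally show ?thesis by auto
qed

lemma half_arc:
  obtains g where "arc g" "pathstart g = a" "pathfinish g = b"
    "path_image g = (\<Union>s\<in>path_edges half. convex hull s)"
proof -
  have "noncrossing (path_edges half)"
    using sides_noncrossing by (rule noncrossing_subset) (simp add: whole_sides)
  then show ?thesis using polygonal_arc[of half] distinct that by auto
qed

text \<open>The two boundary arcs and the diagonal form a theta curve: three arcs from \<open>a\<close> to \<open>b\<close> that are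
otherwise disjoint, the third of which runs inside the closed curve formed by the first two.\<close>

lemma interiors:
  "polygon_interior half \<inter> polygon_interior other = {}"
  "polygon_interior half \<union> polygon_interior other \<union> open_segment a b = polygon_interior whole"
proof -
  interpret sw: split_polygon b a ys xs by (rule swap)
  obtain g where g: "arc g" "pathstart g = a" "pathfinish g = b"
    "path_image g = (\<Union>s\<in>path_edges half. convex hull s)"
    by (rule half_arc)
  obtain h where h: "arc h" "pathstart h = b" "pathfinish h = a"
    "path_image h = (\<Union>s\<in>path_edges other. convex hull s)"
    by (rule sw.half_arc)
  have ab: "a \<noteq> b" using distinct by auto
  have whole_boundary: "path_image g \<union> path_image h = polygon_boundary whole"
    unfolding g h polygon_boundary_def whole_sides by (simp add: UN_Un)
  have boundary1: "path_image g \<union> closed_segment a b = polygon_boundary half"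
    by (simp add: g half_boundary)
  have boundary2: "path_image h \<union> closed_segment a b = polygon_boundary other"
    by (simp add: h sw.half_boundary closed_segment_commute)
  have "open_segment a b \<noteq> {}" using ab by simp
  then have ne: "closed_segment a b \<inter> inside (path_image g \<union> path_image h) \<noteq> {}"
    using segment_interior segment_open_subset_closed[of a b]
    unfolding whole_boundary polygon_interior_def by blast
  have meets: "path_image g \<inter> path_image h = {a, b}" "path_image g \<inter> closed_segment a b = {a, b}"
    "path_image h \<inter> closed_segment a b = {a, b}"
    using arcs_meet arc_meets_diagonal sw.arc_meets_diagonal
    by (auto simp: g h closed_segment_commute)
  have "inside (path_image g \<union> closed_segment a b) \<inter> inside (path_image h \<union> closed_segment a b) = {} \<and>
    inside (path_image g \<union> closed_segment a b) \<union> inside (path_image h \<union> closed_segment a b) \<union>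
      (closed_segment a b - {a, b}) = inside (path_image g \<union> path_image h)"
    by (rule split_inside_simple_closed_curve[of g a b "reversepath h" "linepath a b"])
      (use g(1-3) h(1-3) ab meets ne in
        \<open>simp_all add: arc_imp_simple_path simple_path_reversepath\<close>)
  then show "polygon_interior half \<inter> polygon_interior other = {}"
    "polygon_interior half \<union> polygon_interior other \<union> open_segment a b = polygon_interior whole"
    unfolding boundary1 boundary2 whole_boundary polygon_interior_def[symmetric] open_segment_def
    by simp_all
qed

end

text \<open>The ends are removed because they lie on the boundary of the polygon. The set \<open>D\<close> may contain
diagonals of a larger polygon; those that lie in \<open>vs\<close> are selected.\<close>

definition inner_diagonals :: "complex list \<Rightarrow> complex set set \<Rightarrow> complex set set" where
  "inner_diagonals vs D = {s \<in> D. convex hull s - s \<subseteq> polygon_interior vs}"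

lemma polygon_diagonals_cases:
  assumes "s \<in> polygon_diagonals vs"
  obtains u v where "s = {u, v}" "u \<in> set vs" "v \<in> set vs" "u \<noteq> v" "s \<notin> cycle_edges vs"
    "convex hull s - s = open_segment u v" "open_segment u v \<subseteq> polygon_interior vs"
proof -
  obtain u v where "s = {u, v}" "u \<in> set vs" "v \<in> set vs" "u \<noteq> v" "s \<notin> cycle_edges vs"
    "open_segment u v \<subseteq> polygon_interior vs"
    using assms unfolding polygon_diagonals_def by blast
  then show ?thesis using that hull_minus_ends[of u v] by simp
qed

lemma in_closure_open_segment:
  fixes u v :: complex
  assumes "u \<noteq> v" "open_segment u v \<subseteq> S"
  shows "closed_segment u v \<subseteq> closure S"
  using closure_mono[OF assms(2)] assms(1) by (simp add: closure_open_segment)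

lemma disjoint_closure:
  assumes "open A" "A \<inter> B = {}"
  shows "A \<inter> closure B = {}"
  using open_Int_closure_eq_empty[OF assms(1)] assms(2) by blast

locale split_triangulation = split_polygon +
  fixes D :: "complex set set"
  assumes triangulation: "polygon_triangulation whole D" and in_D: "{a, b} \<in> D"
begin

lemma swap_triangulation: "split_triangulation b a ys xs D"
proof -
  have *: "cycle_edges (b # ys @ a # xs) = cycle_edges whole"
    using cycle_edges_rotate[of "a # xs" "b # ys"] by simp
  show ?thesis
    using swap triangulation in_D polygon_cong(5)[OF *]
    by (simp add: split_triangulation_def split_triangulation_axioms_def insert_commute)
qed

abbreviation "D_half \<equiv> inner_diagonals half D"
abbreviation "D_other \<equiv> inner_diagonals other D"

lemma D_diagonals: "D \<subseteq> polygon_diagonals whole" and D_noncrossing: "noncrossing D"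
  using triangulation by (auto simp: polygon_triangulation_def)

lemma D_cases:
  assumes "s \<in> D"
  obtains u v where "s = {u, v}" "u \<in> set whole" "v \<in> set whole" "u \<noteq> v"
    "convex hull s - s = open_segment u v" "open_segment u v \<subseteq> polygon_interior whole"
  by (rule polygon_diagonals_cases[OF subsetD[OF D_diagonals assms]]) (rule that)

lemma half_interior: "polygon_interior half \<subseteq> polygon_interior whole"
  using interiors(2) by blast

text \<open>Any other diagonal is disjoint from the open segment between \<open>a\<close> and \<open>b\<close>, so its relative interior
is covered by the interiors of the two parts. These are open and disjoint, and the relative interior
is connected, so only one of them is needed.\<close>

lemma D_split: "D = {{a, b}} \<union> D_half \<union> D_other"
proof
  show "{{a, b}} \<union> D_half \<union> D_other \<subseteq> D"
    using in_D by (auto simp: inner_diagonals_def)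
  show "D \<subseteq> {{a, b}} \<union> D_half \<union> D_other"
  proof
    fix s assume s: "s \<in> D"
    then obtain u v where uv: "s = {u, v}" "convex hull s - s = open_segment u v"
      "open_segment u v \<subseteq> polygon_interior whole"
      by (rule D_cases)
    show "s \<in> {{a, b}} \<union> D_half \<union> D_other"
    proof (cases "s = {a, b}")
      case False
      then have "convex hull s \<inter> convex hull {a, b} = s \<inter> {a, b}"
        by (intro noncrossingD[OF D_noncrossing s in_D])
      then have "open_segment u v \<inter> open_segment a b = {}"
        unfolding uv(2)[symmetric] hull_diagonal by blast
      then have sub: "open_segment u v \<subseteq> polygon_interior half \<union> polygon_interior other"
        using uv(3) interiors(2) by blast
      have "polygon_interior half \<inter> open_segment u v = {} \<or> polygon_interior other \<inter> open_segment u v = {}"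
        using sub interiors(1)
        by (intro connectedD[OF convex_connected[OF convex_open_segment]] open_polygon_interior) auto
      then have "open_segment u v \<subseteq> polygon_interior half \<or> open_segment u v \<subseteq> polygon_interior other"
        using sub by blast
      then show ?thesis using s by (simp add: inner_diagonals_def uv(2))
    qed simp
  qed
qed

text \<open>The boundary of a part consists of sides of the whole polygon, which contain no vertices but their
ends, and of the cutting diagonal, whose relative interior contains no vertices at all.\<close>

lemma boundary_of_half_vertex:
  assumes "u \<in> set whole" "u \<in> polygon_boundary half"
  shows "u \<in> set half"
proof -
  obtain s where s: "s \<in> cycle_edges half" "u \<in> convex hull s"
    using assms(2) unfolding polygon_boundary_def by blast
  show ?thesis
  proof (cases "s = {a, b}")
    case True
    then have "u \<notin> open_segment a b"
      using assms(1) vertex_in_boundary[of whole] segment_interior interior_boundary_disjoint[of whole] by blast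
    then show ?thesis using s(2) True hull_diagonal by auto
  next
    case False
    then have "s \<in> path_edges half" using s(1) half_sides by simp
    then have "u \<in> s" using vertex_on_side[OF simple assms(1) _ s(2)] whole_sides by simp
    then show ?thesis using cycle_edges_subset[OF s(1)] by blast
  qed
qed

lemma D_half_diagonals: "D_half \<subseteq> polygon_diagonals half"
proof
  fix s assume s: "s \<in> D_half"
  then have "s \<in> D" by (simp add: inner_diagonals_def)
  then obtain u v where uv: "s = {u, v}" "u \<in> set whole" "v \<in> set whole" "u \<noteq> v"
    "convex hull s - s = open_segment u v"
    by (rule D_cases)
  have inner: "open_segment u v \<subseteq> polygon_interior half"
    using s by (simp add: inner_diagonals_def uv(5))
  have closure: "{u, v} \<subseteq> polygon_boundary half \<union> polygon_interior half"
    using in_closure_open_segment[OF uv(4) inner] closure_polygon_interior[of half]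
      ends_in_segment[of u v] by blast
  have "{u, v} \<inter> polygon_interior half = {}"
    using uv(2,3) vertex_in_boundary[of whole] half_interior interior_boundary_disjoint[of whole] by blast
  then have "u \<in> set half" "v \<in> set half"
    using closure uv(2,3) by (auto intro!: boundary_of_half_vertex simp del: set_simps set_append)
  moreover have "{u, v} \<notin> cycle_edges half"
  proof
    assume "{u, v} \<in> cycle_edges half"
    then have "open_segment u v \<subseteq> polygon_boundary half"
      using side_in_boundary[of "{u, v}" half] uv(1,5) by blast
    then have "open_segment u v = {}" using inner interior_boundary_disjoint[of half] by blast
    then show False using uv(4) by simp
  qed
  ultimately show "s \<in> polygon_diagonals half"
    unfolding polygon_diagonals_def using uv(1,4) inner by blast
qed

text \<open>This keeps the sides of a triangle in the same part as the triangle. A diagonal in the other part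
runs through an open set disjoint from the interior of this part, hence disjoint from the closure of
that interior. A side on the other arc would have to lie on the boundary of this part, but it
meets that boundary in \<open>a\<close> and \<open>b\<close> at most.\<close>

lemma edge_near_half:
  assumes s: "s \<in> cycle_edges whole \<union> D" and near: "convex hull s \<subseteq> closure (polygon_interior half)"
  shows "s \<in> cycle_edges half \<union> D_half"
proof (rule ccontr)
  assume "s \<notin> cycle_edges half \<union> D_half"
  then have sab: "s \<noteq> {a, b}" and "s \<in> path_edges other \<or> s \<in> D_other"
    using s whole_sides half_sides D_split by auto
  from this(2) show False
  proof
    assume o: "s \<in> D_other"
    then have "s \<in> D" by (simp add: inner_diagonals_def)
    then obtain u v where uv: "s = {u, v}" "u \<noteq> v" "convex hull s - s = open_segment u v"
      by (rule D_cases)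
    have "open_segment u v \<subseteq> polygon_interior other" using o uv(3) by (simp add: inner_diagonals_def)
    moreover have "open_segment u v \<subseteq> closure (polygon_interior half)" using near uv(3) by blast
    moreover have "polygon_interior other \<inter> closure (polygon_interior half) = {}"
      using interiors(1) by (intro disjoint_closure open_polygon_interior) blast
    ultimately have "open_segment u v = {}" by blast
    then show False using uv(2) by simp
  next
    assume o: "s \<in> path_edges other"
    then have side: "s \<in> cycle_edges whole" using whole_sides by simp
    obtain p q where pq: "s = {p, q}" "p \<noteq> q"
      using path_edges_pair[OF o] distinct by auto
    have "convex hull s \<inter> polygon_interior half = {}"
      using side_in_boundary[OF side] half_interior interior_boundary_disjoint[of whole] by blast
    then have "convex hull s \<subseteq> polygon_boundary half"
      using near closure_polygon_interior[of half] by blast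
    moreover have "convex hull s \<inter> convex hull t \<subseteq> {a, b}" if "t \<in> cycle_edges half" for t
    proof (cases "t = {a, b}")
      case True
      then show ?thesis using side_meets_diagonal[OF side] by simp
    next
      case False
      then have "t \<in> path_edges half" using that half_sides by simp
      then show ?thesis using arcs_meet o by blast
    qed
    ultimately have "convex hull s \<subseteq> {a, b}"
      unfolding polygon_boundary_def by blast
    then have "{p, q} \<subseteq> {a, b}" using subset_convex_hull[of s] pq(1) by blast
    then have "s = {a, b}" using pq by auto
    then show False using sab by simp
  qed
qed

lemma interior_half_minus:
  "polygon_interior half - (\<Union>d\<in>D_half. convex hull d) = polygon_interior half - (\<Union>d\<in>D. convex hull d)"
proof -
  have "polygon_interior half \<inter> convex hull s = {}" if s: "s = {a, b} \<or> s \<in> D_other" for s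
  proof -
    have "s \<in> D" using s in_D by (auto simp: inner_diagonals_def)
    then obtain u v where uv: "s = {u, v}" "u \<in> set whole" "v \<in> set whole"
      by (rule D_cases)
    then have "s \<inter> polygon_interior half = {}"
      using vertex_in_boundary[of whole] half_interior interior_boundary_disjoint[of whole] by blast
    moreover have "(convex hull s - s) \<inter> polygon_interior half = {}"
    proof (cases "s = {a, b}")
      case True
      have "convex hull s \<subseteq> polygon_boundary half"
        unfolding True half_boundary by (simp add: segment_convex_hull)
      then show ?thesis using interior_boundary_disjoint[of half] by blast
    next
      case False
      then show ?thesis using s interiors(1) by (auto simp: inner_diagonals_def)
    qed
    ultimately show ?thesis by blast
  qed
  then show ?thesis using D_split by blast
qed

text \<open>The pieces of one part are pieces of the whole polygon, since a connected set that avoids the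
cutting diagonal cannot pass to the other part. The corresponding triangle lies in the closure of the
interior of the part, so its sides belong to the part by \<open>edge_near_half\<close>.\<close>

lemma half_triangulation: "polygon_triangulation half D_half"
  unfolding polygon_triangulation_def
proof (intro conjI ballI D_half_diagonals)
  show "noncrossing D_half"
    using D_noncrossing by (rule noncrossing_subset) (auto simp: inner_diagonals_def)
  fix T assume "T \<in> components (polygon_interior half - (\<Union>d\<in>D_half. convex hull d))"
  then have T: "T \<in> components (polygon_interior half - (\<Union>d\<in>D. convex hull d))"
    unfolding interior_half_minus .
  let ?X = "polygon_interior whole - (\<Union>d\<in>D. convex hull d)"
  have X: "?X \<subseteq> polygon_interior half \<union> polygon_interior other"
  proof -
    have "open_segment a b \<subseteq> (\<Union>d\<in>D. convex hull d)"
      using in_D hull_diagonal by blast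
    then show ?thesis using interiors(2) by blast
  qed
  have T_half: "T \<noteq> {}" "T \<subseteq> polygon_interior half - (\<Union>d\<in>D. convex hull d)" "connected T"
    and T_max: "\<And>U. U \<noteq> {} \<Longrightarrow> T \<subseteq> U \<Longrightarrow> U \<subseteq> polygon_interior half - (\<Union>d\<in>D. convex hull d) \<Longrightarrow>
      connected U \<Longrightarrow> U = T"
    using T unfolding in_components_maximal by blast+
  have "T \<in> components ?X"
    unfolding in_components_maximal
  proof (intro conjI allI impI)
    show "T \<noteq> {}" "connected T" "T \<subseteq> ?X" using T_half half_interior by blast+
    fix U assume U: "U \<noteq> {} \<and> T \<subseteq> U \<and> U \<subseteq> ?X \<and> connected U"
    have "polygon_interior half \<inter> U = {} \<or> polygon_interior other \<inter> U = {}"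
      using U X interiors(1) by (intro connectedD open_polygon_interior) auto
    moreover have "polygon_interior half \<inter> U \<noteq> {}" using T_half U by blast
    ultimately have "U \<subseteq> polygon_interior half" using U X by blast
    then show "U = T" using U by (intro T_max) auto
  qed
  moreover have "\<exists>x y z. \<not> collinear {x, y, z} \<and>
      {{x, y}, {y, z}, {z, x}} \<subseteq> cycle_edges whole \<union> D \<and> U = interior (convex hull {x, y, z})"
    if "U \<in> components ?X" for U
    using triangulation that unfolding polygon_triangulation_def by simp
  ultimately obtain x y z where xyz: "\<not> collinear {x, y, z}"
    "{{x, y}, {y, z}, {z, x}} \<subseteq> cycle_edges whole \<union> D" "T = interior (convex hull {x, y, z})"
    by metis
  have "convex hull {x, y, z} \<subseteq> closure (polygon_interior half)"
  proof -
    have "convex hull {x, y, z} \<subseteq> closure (convex hull {x, y, z})" by (rule closure_subset)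
    also have "\<dots> = closure T"
      unfolding xyz(3) using T_half(1) xyz(3)
      by (intro convex_closure_interior[symmetric] convex_convex_hull) auto
    also have "\<dots> \<subseteq> closure (polygon_interior half)" using T_half by (intro closure_mono) blast
    finally show ?thesis .
  qed
  then have "s \<in> cycle_edges half \<union> D_half"
    if "s \<in> cycle_edges whole \<union> D" "s \<subseteq> {x, y, z}" for s
    using edge_near_half[OF that(1)] hull_mono[OF that(2), of convex] by simp
  then have "{{x, y}, {y, z}, {z, x}} \<subseteq> cycle_edges half \<union> D_half"
    using xyz(2) by (simp only: insert_subset) simp
  then show "\<exists>a b c. \<not> collinear {a, b, c} \<and> {{a, b}, {b, c}, {c, a}} \<subseteq> cycle_edges half \<union> D_half \<and>
      T = interior (convex hull {a, b, c})"
    using xyz(1,3) by blast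
qed

lemma two_tree_whole:
  assumes "two_tree e (set half) (cycle_edges half \<union> D_half)"
    and "two_tree {a, b} (set other) (cycle_edges other \<union> D_other)"
  shows "two_tree e (set whole) (cycle_edges whole \<union> D)"
proof -
  have "two_tree e (set half \<union> set other)
    ((cycle_edges half \<union> D_half) \<union> (cycle_edges other \<union> D_other))"
    using distinct half_sides by (intro two_tree_glue[OF assms(2,1)]) auto
  moreover have "set half \<union> set other = set whole" by auto
  moreover have "(cycle_edges half \<union> D_half) \<union> (cycle_edges other \<union> D_other) = cycle_edges whole \<union> D"
    unfolding half_sides other_sides whole_sides by (subst (3) D_split) blast
  ultimately show ?thesis by simp
qed

end

section \<open>Triangulated polygons are two-trees\<close>

text \<open>Without diagonals every piece is a component of the interior, and its three sides are sides of the
polygon. One such piece exists because the interior is nonempty.\<close>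

lemma undivided_polygon:
  assumes "simple_polygon vs" "polygon_triangulation vs {}" "e \<in> cycle_edges vs"
  shows "two_tree e (set vs) (cycle_edges vs)"
proof -
  obtain T where "T \<in> components (polygon_interior vs)"
    using polygon_interior_nonempty[OF assms(1)] components_eq_empty by blast
  then obtain a b c where abc: "\<not> collinear {a, b, c}" "{{a, b}, {b, c}, {c, a}} \<subseteq> cycle_edges vs"
    using assms(2) unfolding polygon_triangulation_def by auto
  have "a \<noteq> b" "b \<noteq> c" "c \<noteq> a" using abc(1) by (auto simp: insert_commute)
  then obtain p q where pq: "distinct [a, p, q]" "cycle_edges vs = cycle_edges [a, p, q]"
    using cycle_with_triangle[of vs a b c] assms(1) abc(2) by (auto simp: simple_polygon_def)
  then have "set vs = {a, p, q}" using polygon_cong(1)[of vs "[a, p, q]"] by simp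
  then show ?thesis using two_tree_triangle[OF pq(1), of e] assms(3) pq(2) by simp
qed

text \<open>Cut along any diagonal. The part whose boundary contains \<open>e\<close> is constructed starting from \<open>e\<close>, the
other part starting from the diagonal, and the second construction is appended to the first.\<close>

theorem triangulated_polygon_two_tree:
  assumes "simple_polygon vs" "polygon_triangulation vs D" "e \<in> cycle_edges vs"
  shows "two_tree e (set vs) (cycle_edges vs \<union> D)"
  using assms
proof (induction "length vs" arbitrary: vs D e rule: less_induct)
  case less
  show ?case
  proof (cases "D = {}")
    case True
    then show ?thesis using undivided_polygon less.prems by simp
  next
    case False
    then obtain d where "d \<in> D" by blast
    then have "d \<in> polygon_diagonals vs"
      using less.prems(2) by (auto simp: polygon_triangulation_def)
    then obtain a b where d: "d = {a, b}" "a \<in> set vs" "b \<in> set vs" "a \<noteq> b"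
      by (rule polygon_diagonals_cases)
    obtain as bs where as: "vs = as @ a # bs" using d(2) by (meson split_list)
    then have "b \<in> set (bs @ as)" using d by auto
    then obtain xs ys where xs: "bs @ as = xs @ b # ys" by (meson split_list)
    let ?ws = "a # xs @ b # ys"
    have ce: "cycle_edges vs = cycle_edges ?ws"
      using cycle_edges_rotate[of as "a # bs"] as xs by simp
    have len: "length vs = length ?ws"
      using as arg_cong[OF xs, of length] by simp
    have "distinct vs \<longleftrightarrow> distinct (a # bs @ as)" unfolding as by auto
    then have dist: "distinct vs \<longleftrightarrow> distinct ?ws" unfolding xs by simp
    have simple: "simple_polygon ?ws"
      using less.prems(1) unfolding simple_polygon_def ce len dist .
    have diag: "{a, b} \<in> polygon_diagonals ?ws"
      using \<open>d \<in> polygon_diagonals vs\<close> d(1) polygon_cong(4)[OF ce] by simp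
    have tri: "polygon_triangulation ?ws D"
      using less.prems(2) polygon_cong(5)[OF ce] by simp
    interpret split_triangulation a b xs ys D
      using simple diag tri \<open>d \<in> D\<close> d(1) by unfold_locales auto
    interpret sw: split_triangulation b a ys xs D by (rule swap_triangulation)
    have half: "two_tree f (set half) (cycle_edges half \<union> D_half)" if "f \<in> cycle_edges half" for f
      using that half_simple half_triangulation ys_nonempty
      by (intro less.hyps) (auto simp: len simp del: set_simps)
    have other: "two_tree f (set other) (cycle_edges other \<union> D_other)" if "f \<in> cycle_edges other" for f
      using that sw.half_simple sw.half_triangulation xs_nonempty
      by (intro less.hyps) (auto simp: len simp del: set_simps)
    have "e \<in> path_edges half \<or> e \<in> path_edges other"
      using less.prems(3) unfolding ce whole_sides by simp
    then have "two_tree e (set ?ws) (cycle_edges ?ws \<union> D)"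
    proof
      assume "e \<in> path_edges half"
      then show ?thesis
        by (intro two_tree_whole half other) (simp_all add: half_sides other_sides)
    next
      assume "e \<in> path_edges other"
      then have "two_tree e (set (b # ys @ a # xs)) (cycle_edges (b # ys @ a # xs) \<union> D)"
        by (intro sw.two_tree_whole half other)
          (simp_all add: half_sides other_sides insert_commute)
      moreover have "cycle_edges (b # ys @ a # xs) = cycle_edges ?ws"
        using cycle_edges_rotate[of "a # xs" "b # ys"] by simp
      moreover have "set (b # ys @ a # xs) = set ?ws" by auto
      ultimately show ?thesis by simp
    qed
    then show ?thesis using ce polygon_cong(1)[OF ce] by simp
  qed
qed

theorem corollary4p8:
  fixes vs :: "complex list" and D :: "complex set set" and G :: "complex graph"
  assumes "simple_polygon vs"
    and "polygon_triangulation vs D"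
    and "G = triangulation_graph vs D"
  shows "\<exists>r. linear_order_on (ground (cycle_matroid G)) r \<and>
           pairwise disjnt (minimal_broken_circuits (cycle_matroid G) r)"
proof -
  have "set vs \<noteq> {}" using assms(1) by (auto simp: simple_polygon_def)
  then have "cycle_edges vs \<noteq> {}" using Union_cycle_edges[of vs] by auto
  then obtain e where "e \<in> cycle_edges vs" by blast
  then have "two_tree e (set vs) (cycle_edges vs \<union> D)"
    by (rule triangulated_polygon_two_tree[OF assms(1,2)])
  from two_tree_minimal_broken_circuits[OF this] show ?thesis
    unfolding assms(3) triangulation_graph_def by (simp add: cycle_matroid_def)
qed

end
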